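(* Let $A,B,H,K$ be any logically independent events. Given a coherent assessment $(x,y)$ on $\{A|H,B|K\}$, for the iterated conditional $(B|K)|_L(A|H)$ the extension $\mu_L=\mathbb{P}((B|K)|_L(A|H))$ is coherent if and only if $\mu_L\in[\mu_L',\mu_L'']$, where $$\mu_L'=0,\qquad \mu_L''=\begin{cases}\min\left\{1,\tfrac{y}{x}\right\}, & \text{if } x>0,\\ 1, & \text{if } x=0.\end{cases}$$
   Context: Events are two-valued entities identified with their indicators (values $1/0$); $\emptyset$ is the impossible event, $AB=A\wedge B$, $\overline{A}$ is the negation. Four events are logically independent if all $16$ conjunctions obtained by taking each event or its negation are different from $\emptyset$. For $H\neq\emptyset$ the conditional event $E|H$ is true if $EH$ is true, false if $\overline{E}H$ is true, void if $\overline{H}$ is true. Once $P(E|H)=p$ is assessed, $E|H$ is also the random quantity $EH+p\overline{H}$; numerically $\overline{A}|H=1-A|H$. Lukasiewicz conjunction (a conditional event): $(A|H)\wedge_L(B|K)=AHBK|(AHBK\vee\overline{A}H\vee\overline{B}K\vee\overline{H}\,\overline{K})$. Iterated conditional: $(B|K)|_L(A|H)$ is the random quantity $(A|H)\wedge_L(B|K)+\mu_L\,(\overline{A}|H)$, where $\mu_L$ is its assessed prevision (the amount paid to receive it), the right-hand side being computed numerically from $x=P(A|H)$, $z=P[(A|H)\wedge_L(B|K)]$ and $\mu_L$. Also $y=P(B|K)$. Coherence: an assessment of real values $m_j$ on a finite family of such objects $X_j$ (conditional events, as random quantities, and iterated conditionals) is coherent iff for every nonempty subfamily $J$ and all reals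 $s_j$, the random gain $\sum_{j\in J}s_j(X_j-m_j)$, restricted to the cases where at least one of the bets in $J$ is not called off, has minimum $\le 0$ and maximum $\ge 0$. A bet on a conditional event is called off when it is void; a bet on the iterated conditional is called off in the cases where one receives back the paid amount $\mu_L$ whatever it is (taking into account the relation $z=x\mu_L$ required by linearity of coherent previsions). The value $\mu_L$ is a coherent extension of $(x,y)$ iff there is $z$ such that $(x,y,z,\mu_L)$ is coherent on $\{A|H,B|K,(A|H)\wedge_L(B|K),(B|K)|_L(A|H)\}$. *)

theory Defs
  imports Complex_Main "HOL-Library.Indicator_Function"
begin

text \<open>Events are sets of possible cases; \<open>UNIV\<close> is the sure event, \<open>{}\<close> the impossible one.\<close>

definition literal :: "bool \<Rightarrow> 'w set \<Rightarrow> 'w set" where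
  "literal b E = (if b then E else - E)"

definition logically_independent :: "'w set \<Rightarrow> 'w set \<Rightarrow> 'w set \<Rightarrow> 'w set \<Rightarrow> bool" where
  "logically_independent A B H K \<longleftrightarrow>
     (\<forall>a b h k. literal a A \<inter> literal b B \<inter> literal h H \<inter> literal k K \<noteq> {})"

text \<open>\<open>E \<parallel> H\<close> is the conditional event \<open>E|H\<close>; it is only meaningful for \<open>H \<noteq> {}\<close>.\<close>

datatype 'w cond_event = Cond "'w set" "'w set" (infix "\<parallel>" 55)

primrec void :: "'w cond_event \<Rightarrow> 'w set" where
  "void (E \<parallel> H) = - H"

primrec cond_quantity :: "'w cond_event \<Rightarrow> real \<Rightarrow> 'w \<Rightarrow> real" where
  "cond_quantity (E \<parallel> H) p w = indicator (E \<inter> H) w + p * indicator (- H) w"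

primrec neg_cond :: "'w cond_event \<Rightarrow> 'w cond_event" where
  "neg_cond (E \<parallel> H) = - E \<parallel> H"

fun conj_L :: "'w cond_event \<Rightarrow> 'w cond_event \<Rightarrow> 'w cond_event" where
  "conj_L (A \<parallel> H) (B \<parallel> K) =
     (A \<inter> H \<inter> B \<inter> K \<parallel> (A \<inter> H \<inter> B \<inter> K) \<union> (- A \<inter> H) \<union> (- B \<inter> K) \<union> (- H \<inter> - K))"

text \<open>The iterated conditional \<open>d |\<^sub>L c\<close> as a random quantity, where \<open>x\<close>, \<open>z\<close> and \<open>\<mu>\<close> are the
  values assessed for \<open>c\<close>, \<open>conj_L c d\<close> and \<open>d |\<^sub>L c\<close>. The negation of \<open>c\<close> then has the value
  \<open>1 - x\<close>, which by the lemma below makes it numerically one minus \<open>c\<close>.\<close>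

definition iter_L_quantity ::
    "'w cond_event \<Rightarrow> 'w cond_event \<Rightarrow> real \<Rightarrow> real \<Rightarrow> real \<Rightarrow> 'w \<Rightarrow> real" where
  "iter_L_quantity d c x z \<mu> w =
     cond_quantity (conj_L c d) z w + \<mu> * cond_quantity (neg_cond c) (1 - x) w"

lemma cond_quantity_neg_cond: "cond_quantity (neg_cond c) (1 - x) w = 1 - cond_quantity c x w"
  by (cases c) (auto simp: indicator_def)

datatype 'w bet = Bet (quantity: "'w \<Rightarrow> real") (price: real) (called_off: "'w set")

definition cond_bet :: "'w cond_event \<Rightarrow> real \<Rightarrow> 'w bet" where
  "cond_bet c p = Bet (cond_quantity c p) p (void c)"

text \<open>The bet on an iterated conditional is called off in the cases where the price is returned
  whatever its amount \<open>m\<close>, with \<open>x\<close> kept fixed and \<open>z = x * m\<close>. These cases depend on \<open>x\<close>: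
  for \<open>x = 0\<close> they include all of the negation of \<open>H\<close>, and for \<open>x = 1\<close> also \<open>A \<inter> H \<inter> - K\<close>
  (when \<open>c = A \<parallel> H\<close> and \<open>d = B \<parallel> K\<close>).\<close>

definition iter_L_bet ::
    "'w cond_event \<Rightarrow> 'w cond_event \<Rightarrow> real \<Rightarrow> real \<Rightarrow> real \<Rightarrow> 'w bet" where
  "iter_L_bet d c x z \<mu> =
     Bet (iter_L_quantity d c x z \<mu>) \<mu> {w. \<forall>m. iter_L_quantity d c x (x * m) m w = m}"

text \<open>A family of bets is a list, so that repeated members are counted separately; subfamilies
  are sets of positions.\<close>

definition gain :: "'w bet list \<Rightarrow> nat set \<Rightarrow> (nat \<Rightarrow> real) \<Rightarrow> 'w \<Rightarrow> real" where
  "gain bs J s w = (\<Sum>j\<in>J. s j * (quantity (bs ! j) w - price (bs ! j)))"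

definition live_cases :: "'w bet list \<Rightarrow> nat set \<Rightarrow> 'w set" where
  "live_cases bs J = {w. \<exists>j\<in>J. w \<notin> called_off (bs ! j)}"

text \<open>\<open>Min\<close> and \<open>Max\<close> are proper here: quantities of conditional events and iterated conditionals
  have finitely many values (\<open>finite_range_cond_quantity\<close>, \<open>finite_range_iter_L_quantity\<close>), and
  the live cases are nonempty as soon as no bet is called off in every case.\<close>

definition coherent :: "'w bet list \<Rightarrow> bool" where
  "coherent bs \<longleftrightarrow>
     (\<forall>J s. J \<subseteq> {..<length bs} \<and> J \<noteq> {} \<longrightarrow>
        Min (gain bs J s ` live_cases bs J) \<le> 0 \<and> 0 \<le> Max (gain bs J s ` live_cases bs J))"

lemma finite_range_cond_quantity: "finite (range (cond_quantity c p))"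
proof (rule finite_subset)
  show "range (cond_quantity c p) \<subseteq> {0, 1, p}"
    by (cases c) (auto simp: indicator_def)
qed simp

lemma finite_range_iter_L_quantity: "finite (range (iter_L_quantity d c x z \<mu>))"
proof (rule finite_subset)
  let ?f = "cond_quantity (conj_L c d) z" and ?g = "cond_quantity (neg_cond c) (1 - x)"
  show "range (iter_L_quantity d c x z \<mu>) \<subseteq> (\<lambda>(u, v). u + \<mu> * v) ` (range ?f \<times> range ?g)"
    by (auto simp: iter_L_quantity_def)
qed (simp add: finite_range_cond_quantity)

definition coherent_extension ::
    "'w cond_event \<Rightarrow> 'w cond_event \<Rightarrow> real \<Rightarrow> real \<Rightarrow> real \<Rightarrow> bool" where
  "coherent_extension c d x y \<mu> \<longleftrightarrow>
     (\<exists>z. coherent [cond_bet c x, cond_bet d y, cond_bet (conj_L c d) z, iter_L_bet d c x z \<mu>])"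

end

theory Submission
  imports Defs
begin

text \<open>
  A conditional event takes three truth values (true, false, void), and logical independence says
  that all nine pairs of truth values of \<open>A|H\<close> and \<open>B|K\<close> can occur. Everything depends on these
  pairs only.

  The bet on the iterated conditional is, up to a constant, a combination of two other bets:
  \<open>(d|\<^sub>Lc - \<mu>) = (c \<and>\<^sub>L d - z) - \<mu> (c - x) + (z - x \<mu>)\<close>. A combination of the bets thus has the
  constant gain \<open>z - x \<mu>\<close>, so coherence forces \<open>z = x \<mu>\<close>. The bet on the iterated conditional
  alone then forces \<open>0 \<le> \<mu> \<le> 1\<close>, and the bets on \<open>d\<close> and \<open>c \<and>\<^sub>L d\<close> together force \<open>z \<le> y\<close>, that
  is \<open>\<mu> \<le> y / x\<close> when \<open>x > 0\<close>. This is necessity (\<open>coherent_extension_bounds\<close>).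

  For sufficiency, a subfamily admits no sure gain or loss if some probability distribution,
  concentrated on its live cases, gives each of its quantities an expectation equal to its price
  (\<open>coherentI\<close>). With \<open>z = x \<mu>\<close> one gets \<open>0 \<le> z \<le> min x y\<close>. For each of \<open>c\<close>, \<open>d\<close> and
  \<open>c \<and>\<^sub>L d\<close> there is a distribution on its non-void cases under which \<^emph>\<open>all four\<close> bets are fair, the
  fourth by the identity above (\<open>fair_on_antecedent\<close>, \<open>fair_on_consequent\<close>,
  \<open>fair_on_conjunction\<close>). This settles every subfamily that contains one of the three. What remains
  is the iterated conditional alone, which is \<open>1\<close> in one live case and \<open>0\<close> in another.
\<close>

section \<open>Coherence and fair distributions\<close>

lemma finite_range_gain:
  assumes "finite J" and "\<forall>j\<in>J. finite (range (quantity (bs ! j)))"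
  shows "finite (range (gain bs J s))"
  using assms
proof (induction J rule: finite_induct)
  case empty
  then show ?case by (simp add: gain_def)
next
  case (insert j J)
  let ?f = "\<lambda>(u, v). s j * (u - price (bs ! j)) + v"
  have "range (gain bs (insert j J) s)
      \<subseteq> ?f ` (range (quantity (bs ! j)) \<times> range (gain bs J s))"
    using insert.hyps by (auto simp: gain_def)
  then show ?case
    by (rule finite_subset) (use insert in auto)
qed

lemma finite_gain_image:
  assumes "\<forall>b\<in>set bs. finite (range (quantity b))" and "J \<subseteq> {..<length bs}"
  shows "finite (gain bs J s ` S)"
proof -
  have "finite (range (gain bs J s))"
    using assms by (intro finite_range_gain) (auto intro: finite_subset)
  then show ?thesis
    by (rule finite_subset[rotated]) auto
qed

lemma coherent_no_sure_gain:
  assumes "coherent bs" and "\<forall>b\<in>set bs. finite (range (quantity b))"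
    and "J \<subseteq> {..<length bs}" and "live_cases bs J \<noteq> {}"
  obtains w where "w \<in> live_cases bs J" and "gain bs J s w \<le> 0"
proof -
  let ?G = "gain bs J s ` live_cases bs J"
  have "J \<noteq> {}"
    using assms(4) by (auto simp: live_cases_def)
  then have "Min ?G \<le> 0"
    using assms(1,3) by (auto simp: coherent_def)
  moreover have "Min ?G \<in> ?G"
    using assms by (intro Min_in finite_gain_image) auto
  ultimately show thesis
    using that by auto
qed

definition expectation :: "(real \<times> 'w) list \<Rightarrow> ('w \<Rightarrow> real) \<Rightarrow> real" where
  "expectation P f = (\<Sum>(p, w)\<leftarrow>P. p * f w)"

text \<open>A finitely supported distribution is a list of weighted cases, so that explicit
  distributions can be evaluated without knowing that their cases are distinct.\<close>

definition distribution_on :: "'w set \<Rightarrow> (real \<times> 'w) list \<Rightarrow> bool" where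
  "distribution_on S P \<longleftrightarrow> (\<forall>(p, w)\<in>set P. 0 \<le> p \<and> w \<in> S) \<and> expectation P (\<lambda>_. 1) = 1"

lemma distribution_on_mono:
  "distribution_on S P \<Longrightarrow> S \<subseteq> T \<Longrightarrow> distribution_on T P"
  unfolding distribution_on_def by blast

lemma expectation_add: "expectation P (\<lambda>w. f w + g w) = expectation P f + expectation P g"
  by (induction P) (auto simp: expectation_def algebra_simps)

lemma expectation_cmult: "expectation P (\<lambda>w. a * f w) = a * expectation P f"
  by (induction P) (auto simp: expectation_def algebra_simps)

lemma expectation_const: "distribution_on S P \<Longrightarrow> expectation P (\<lambda>_. a) = a"
  using expectation_cmult[of P a "\<lambda>_. 1"] by (simp add: distribution_on_def)

lemma expectation_sum:
  "finite J \<Longrightarrow> expectation P (\<lambda>w. \<Sum>j\<in>J. f j w) = (\<Sum>j\<in>J. expectation P (f j))"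
proof (induction J rule: finite_induct)
  case empty
  then show ?case using expectation_cmult[of P 0 "\<lambda>_. 0"] by simp
qed (simp add: expectation_add)

lemma expectation_pos:
  assumes P: "distribution_on S P" and f: "\<And>w. w \<in> S \<Longrightarrow> 0 < f w"
  shows "0 < expectation P f"
proof -
  have nonneg: "\<forall>v \<in> set (map (\<lambda>(p, w). p * f w) P). 0 \<le> v"
    using P f by (fastforce simp: distribution_on_def intro: mult_nonneg_nonneg less_imp_le)
  have "expectation P f \<noteq> 0"
  proof
    assume "expectation P f = 0"
    then have "\<forall>v \<in> set (map (\<lambda>(p, w). p * f w) P). v = 0"
      using nonneg sum_list_nonneg_eq_0_iff[of "map (\<lambda>(p, w). p * f w) P"]
      unfolding expectation_def by blast
    then have "\<forall>(p, w)\<in>set P. p = 0"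
      using P f by (fastforce simp: distribution_on_def)
    then have "expectation P (\<lambda>_. 1) = 0"
      unfolding expectation_def by (induction P) auto
    then show False
      using P by (simp add: distribution_on_def)
  qed
  moreover have "0 \<le> expectation P f"
    using nonneg unfolding expectation_def by (intro sum_list_nonneg) auto
  ultimately show ?thesis by simp
qed

text \<open>Under a distribution that makes every bet of the subfamily fair, each gain has expectation
  zero, so it cannot have the same strict sign in all live cases.\<close>

lemma coherentI:
  assumes fin: "\<forall>b\<in>set bs. finite (range (quantity b))"
    and fair: "\<And>J. J \<subseteq> {..<length bs} \<Longrightarrow> J \<noteq> {} \<Longrightarrow>
      \<exists>P. distribution_on (live_cases bs J) P \<and>
        (\<forall>j\<in>J. expectation P (quantity (bs ! j)) = price (bs ! j))"
  shows "coherent bs"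
  unfolding coherent_def
proof (intro allI impI)
  fix J :: "nat set" and s :: "nat \<Rightarrow> real"
  let ?L = "live_cases bs J"
  assume J: "J \<subseteq> {..<length bs} \<and> J \<noteq> {}"
  then obtain P where P: "distribution_on ?L P"
    and E: "\<forall>j\<in>J. expectation P (quantity (bs ! j)) = price (bs ! j)"
    using fair by blast
  have zero: "expectation P (gain bs J s) = 0" for s
  proof -
    have "finite J"
      using J finite_subset by blast
    then have "expectation P (gain bs J s) =
        (\<Sum>j\<in>J. expectation P (\<lambda>w. s j * (quantity (bs ! j) w + - price (bs ! j))))"
      unfolding gain_def by (simp add: expectation_sum)
    also have "\<dots> = 0"
      using E by (intro sum.neutral)
        (simp only: expectation_cmult expectation_add expectation_const[OF P]; simp)
    finally show ?thesis .
  qed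
  have le: "\<exists>w\<in>?L. gain bs J s w \<le> 0" for s
    using expectation_pos[OF P, of "gain bs J s"] zero[of s] by force
  have "gain bs J (\<lambda>j. - s j) w = - gain bs J s w" for w
    by (simp add: gain_def sum_negf)
  then have ge: "\<exists>w\<in>?L. 0 \<le> gain bs J s w"
    using le[of "\<lambda>j. - s j"] by simp
  have "finite (gain bs J s ` ?L)"
    using fin J by (intro finite_gain_image) auto
  then show "Min (gain bs J s ` ?L) \<le> 0 \<and> 0 \<le> Max (gain bs J s ` ?L)"
    using le[of s] ge by (meson Min_le Max_ge imageI order_trans)
qed

section \<open>Truth values of conditional events\<close>

text \<open>The value \<open>None\<close> stands for void.\<close>

primrec truth :: "'w cond_event \<Rightarrow> 'w \<Rightarrow> bool option" where
  "truth (E \<parallel> H) w = (if w \<in> H then Some (w \<in> E) else None)"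

lemma void_iff_truth: "w \<in> void c \<longleftrightarrow> truth c w = None"
  by (cases c) auto

lemma cond_quantity_truth:
  "cond_quantity c p w = (case truth c w of Some b \<Rightarrow> of_bool b | None \<Rightarrow> p)"
  by (cases c) (auto simp: indicator_def)

text \<open>Two void conjuncts make a false conjunction, whereas true is neutral.\<close>

lemma truth_conj_L:
  "truth (conj_L c d) w =
    (if truth c w = Some True then truth d w
     else if truth d w = Some True then truth c w else Some False)"
  by (cases c; cases d) auto

definition jointly_unconstrained :: "'w cond_event \<Rightarrow> 'w cond_event \<Rightarrow> bool" where
  "jointly_unconstrained c d \<longleftrightarrow> (\<forall>s t. \<exists>w. truth c w = s \<and> truth d w = t)"

lemma logically_independent_imp_jointly_unconstrained:
  assumes "logically_independent A B H K"
  shows "jointly_unconstrained (A \<parallel> H) (B \<parallel> K)"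
  unfolding jointly_unconstrained_def
proof (intro allI)
  fix s t :: "bool option"
  have "literal (s = Some True) A \<inter> literal (t = Some True) B
      \<inter> literal (s \<noteq> None) H \<inter> literal (t \<noteq> None) K \<noteq> {}"
    using assms unfolding logically_independent_def by blast
  then obtain w where "w \<in> literal (s = Some True) A \<inter> literal (t = Some True) B
      \<inter> literal (s \<noteq> None) H \<inter> literal (t \<noteq> None) K"
    by blast
  then have "truth (A \<parallel> H) w = s \<and> truth (B \<parallel> K) w = t"
    by (cases s; cases t) (auto simp: literal_def split: if_splits)
  then show "\<exists>w. truth (A \<parallel> H) w = s \<and> truth (B \<parallel> K) w = t" ..
qed

text \<open>The identity behind both directions: a bet on the iterated conditional is a bet on the
  conjunction minus \<open>\<mu>\<close> bets on the antecedent, up to a constant.\<close>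

lemma iter_L_quantity_eq:
  "iter_L_quantity d c x z \<mu> w = cond_quantity (conj_L c d) z w + (- \<mu> * cond_quantity c x w + \<mu>)"
  by (simp add: iter_L_quantity_def cond_quantity_neg_cond algebra_simps)

lemma iter_L_quantity_truth:
  "iter_L_quantity d c x (x * m) m w =
    (case truth c w of
       Some True \<Rightarrow> (case truth d w of Some b \<Rightarrow> of_bool b | None \<Rightarrow> x * m)
     | Some False \<Rightarrow> m
     | None \<Rightarrow> if truth d w = Some True then m else (1 - x) * m)"
  by (auto simp: iter_L_quantity_eq cond_quantity_truth truth_conj_L algebra_simps
      split: option.splits bool.splits)

abbreviation iter_L_family ::
    "'w cond_event \<Rightarrow> 'w cond_event \<Rightarrow> real \<Rightarrow> real \<Rightarrow> real \<Rightarrow> real \<Rightarrow> 'w bet list" where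
  "iter_L_family c d x y z \<mu> \<equiv>
     [cond_bet c x, cond_bet d y, cond_bet (conj_L c d) z, iter_L_bet d c x z \<mu>]"

lemma finite_range_cond_bet: "finite (range (quantity (cond_bet c p)))"
  by (simp add: cond_bet_def finite_range_cond_quantity)

lemma finite_range_iter_L_family:
  "\<forall>b\<in>set (iter_L_family c d x y z \<mu>). finite (range (quantity b))"
  by (simp add: finite_range_cond_bet iter_L_bet_def finite_range_iter_L_quantity)

section \<open>Necessity of the bounds\<close>

lemma coherent_cond_bet_unit_interval:
  assumes coh: "coherent bs" and fin: "\<forall>b\<in>set bs. finite (range (quantity b))"
    and j: "j < length bs" "bs ! j = cond_bet c p" and w: "truth c w \<noteq> None"
  shows "0 \<le> p" and "p \<le> 1"
proof -
  have live: "live_cases bs {j} = {w. truth c w \<noteq> None}"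
    using j by (auto simp: live_cases_def cond_bet_def void_iff_truth)
  have gain: "gain bs {j} s w = s j * (cond_quantity c p w - p)" for s w
    using j by (simp add: gain_def cond_bet_def)
  have witness: "\<exists>w. truth c w \<noteq> None \<and> a * (cond_quantity c p w - p) \<le> 0" for a
    by (rule coherent_no_sure_gain[OF coh fin, of "{j}" "\<lambda>_. a"])
      (use j w in \<open>auto simp: live gain\<close>)
  show "0 \<le> p"
    using witness[of 1] by (auto simp: cond_quantity_truth of_bool_def split: if_splits)
  show "p \<le> 1"
    using witness[of "-1"] by (auto simp: cond_quantity_truth of_bool_def split: if_splits)
qed

lemma coherent_conj_prevision:
  assumes coh: "coherent (iter_L_family c d x y z \<mu>)" and w: "truth c w \<noteq> None"
  shows "z = x * \<mu>"
proof -
  let ?bs = "iter_L_family c d x y z \<mu>"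
  \<comment> \<open>the combination with constant gain, oriented so that this gain is nonnegative\<close>
  define s where "s = (\<lambda>j. sgn (z - x * \<mu>) * [\<mu>, 0, - 1, 1] ! j)"
  have "gain ?bs {0, 2, 3} s w = sgn (z - x * \<mu>) * (z - x * \<mu>)" for w
    by (simp add: gain_def s_def cond_bet_def iter_L_bet_def iter_L_quantity_eq algebra_simps)
  moreover have "w \<in> live_cases ?bs {0, 2, 3}"
    using w by (simp add: live_cases_def cond_bet_def void_iff_truth)
  ultimately have "sgn (z - x * \<mu>) * (z - x * \<mu>) \<le> 0"
    using coherent_no_sure_gain[OF coh finite_range_iter_L_family, of "{0, 2, 3}" s] by auto
  then show ?thesis
    by (auto simp: sgn_real_def split: if_splits)
qed

text \<open>In the live cases the iterated conditional is worth \<open>1\<close>, \<open>0\<close>, \<open>x \<mu>\<close> (only if \<open>x < 1\<close>) or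
  \<open>(1 - x) \<mu>\<close> (only if \<open>x > 0\<close>). All these values lie strictly above a negative \<open>\<mu>\<close> and strictly
  below a \<open>\<mu>\<close> larger than one.\<close>

lemma coherent_iter_unit_interval:
  assumes indep: "jointly_unconstrained c d" and x: "0 \<le> x" "x \<le> 1"
    and coh: "coherent (iter_L_family c d x y (x * \<mu>) \<mu>)"
  shows "0 \<le> \<mu>" and "\<mu> \<le> 1"
proof -
  let ?bs = "iter_L_family c d x y (x * \<mu>) \<mu>"
  let ?q = "iter_L_quantity d c x (x * \<mu>) \<mu>"
  have live: "live_cases ?bs {3} = {w. \<exists>m. iter_L_quantity d c x (x * m) m w \<noteq> m}"
    by (simp add: live_cases_def iter_L_bet_def)
  have gain: "gain ?bs {3} s w = s 3 * (?q w - \<mu>)" for s w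
    by (simp add: gain_def iter_L_bet_def)
  obtain w where "truth c w = Some True" "truth d w = Some False"
    using indep unfolding jointly_unconstrained_def by blast
  then have "iter_L_quantity d c x (x * 1) 1 w \<noteq> 1"
    unfolding iter_L_quantity_truth by simp
  then have "live_cases ?bs {3} \<noteq> {}"
    unfolding live by blast
  then have witness: "\<exists>w \<in> live_cases ?bs {3}. a * (?q w - \<mu>) \<le> 0" for a
    using coherent_no_sure_gain[OF coh finite_range_iter_L_family, of "{3}" "\<lambda>_. a"]
    by (auto simp: gain)
  have live_value:
    "?q w = 0 \<or> ?q w = 1 \<or> (?q w = x * \<mu> \<and> x < 1) \<or> (?q w = (1 - x) * \<mu> \<and> x > 0)"
    if w: "w \<in> live_cases ?bs {3}" for w
  proof -
    obtain m where m: "iter_L_quantity d c x (x * m) m w \<noteq> m"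
      using w unfolding live by blast
    consider b where "truth c w = Some True" "truth d w = Some b"
      | "truth c w = Some True" "truth d w = None"
      | "truth c w = Some False" | "truth c w = None" "truth d w = Some True"
      | "truth c w = None" "truth d w \<noteq> Some True"
      by (cases "truth c w"; cases "truth d w") auto
    then show ?thesis
    proof cases
      case 1
      then show ?thesis by (cases b) (simp_all add: iter_L_quantity_truth)
    next
      case 2
      then have "x \<noteq> 1" using m by (auto simp: iter_L_quantity_truth)
      then show ?thesis using 2 x by (simp add: iter_L_quantity_truth)
    next
      case 5
      then have "x \<noteq> 0" using m by (auto simp: iter_L_quantity_truth)
      then show ?thesis using 5 x by (simp add: iter_L_quantity_truth)
    qed (use m in \<open>simp_all add: iter_L_quantity_truth\<close>)
  qed
  show "0 \<le> \<mu>"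
  proof (rule ccontr)
    assume neg: "\<not> 0 \<le> \<mu>"
    obtain w where w: "w \<in> live_cases ?bs {3}" "?q w \<le> \<mu>"
      using witness[of 1] by auto
    have "\<mu> < x * \<mu>" if "x < 1"
      using that neg by (simp add: mult_less_cancel_right2)
    moreover have "\<mu> < (1 - x) * \<mu>" if "x > 0"
      using that neg by (simp add: mult_less_cancel_right2)
    ultimately show False
      using live_value[OF w(1)] w(2) neg by linarith
  qed
  show "\<mu> \<le> 1"
  proof (rule ccontr)
    assume gt: "\<not> \<mu> \<le> 1"
    obtain w where w: "w \<in> live_cases ?bs {3}" "\<mu> \<le> ?q w"
      using witness[of "-1"] by auto
    have "x * \<mu> < \<mu>" if "x < 1"
      using that gt by simp
    moreover have "(1 - x) * \<mu> < \<mu>" if "x > 0"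
      using that gt by simp
    ultimately show False
      using live_value[OF w(1)] w(2) gt by linarith
  qed
qed

text \<open>If \<open>z > y\<close>, buying the consequent and selling the conjunction yields a positive gain
  in every case where at least one of these two bets is on.\<close>

lemma coherent_conj_le_consequent:
  assumes coh: "coherent (iter_L_family c d x y z \<mu>)" and w: "truth d w \<noteq> None"
    and y: "0 \<le> y" and z: "z \<le> 1"
  shows "z \<le> y"
proof (rule ccontr)
  assume gt: "\<not> z \<le> y"
  let ?bs = "iter_L_family c d x y z \<mu>"
  define s where "s = (\<lambda>j::nat. if j = 1 then 1 else - 1 :: real)"
  have "w \<in> live_cases ?bs {1, 2}"
    using w by (simp add: live_cases_def cond_bet_def void_iff_truth)
  then obtain v where v: "v \<in> live_cases ?bs {1, 2}" "gain ?bs {1, 2} s v \<le> 0"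
    using coherent_no_sure_gain[OF coh finite_range_iter_L_family, of "{1, 2}" s] by auto
  have "truth d v \<noteq> None \<or> truth c v \<noteq> Some True"
    using v(1) by (auto simp: live_cases_def cond_bet_def void_iff_truth truth_conj_L)
  moreover have "gain ?bs {1, 2} s v
      = cond_quantity d y v - y - (cond_quantity (conj_L c d) z v - z)"
    by (simp add: gain_def s_def cond_bet_def)
  ultimately show False
    using v(2) y z gt
    by (auto simp: cond_quantity_truth truth_conj_L split: option.splits if_splits)
qed

lemma coherent_extension_bounds:
  assumes indep: "jointly_unconstrained c d" and ext: "coherent_extension c d x y \<mu>"
    and x: "0 \<le> x" "x \<le> 1" and y: "0 \<le> y"
  shows "0 \<le> \<mu>" and "\<mu> \<le> 1" and "x * \<mu> \<le> y"
proof -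
  obtain z where coh: "coherent (iter_L_family c d x y z \<mu>)"
    using ext unfolding coherent_extension_def by blast
  obtain w where w: "truth c w = Some True" "truth d w = Some True"
    using indep unfolding jointly_unconstrained_def by blast
  have z: "z = x * \<mu>"
    using coherent_conj_prevision[OF coh, of w] w by simp
  show \<mu>: "0 \<le> \<mu>" "\<mu> \<le> 1"
    using coherent_iter_unit_interval[OF indep x] coh unfolding z by blast+
  have "x * \<mu> \<le> 1"
    using mult_mono[of x 1 \<mu> 1] x \<mu> by simp
  then show "x * \<mu> \<le> y"
    using coherent_conj_le_consequent[OF coh, of w] w y z by simp
qed

section \<open>Distributions that make all bets fair\<close>

text \<open>Here \<open>z\<close> is any value with \<open>0 \<le> z \<le> min x y\<close>. If \<open>x + y \<le> 1 + z\<close>, the two conditional events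
  can be treated as ordinary events with probabilities \<open>x\<close>, \<open>y\<close> and joint probability \<open>z\<close>.
  Otherwise that would give the case where both are false the negative weight \<open>1 + z - x - y\<close>.
  That case is then left out, and the missing mass goes to a fourth case: \<open>c\<close> true and \<open>d\<close> void, or
  the reverse, or both void, according as \<open>c\<close>, \<open>d\<close> or the conjunction must not be void. Each of
  these cases leaves the other two of these three void, so it affects a single fairness condition.
  The factor \<open>r\<close> is the probability of the first three cases.\<close>

lemma fair_joint_distribution:
  assumes indep: "jointly_unconstrained c d"
    and z: "0 \<le> z" "z \<le> x" "z \<le> y" and sum: "x + y \<le> 1 + z"
  shows "\<exists>P. distribution_on {w. truth c w \<noteq> None \<and> truth d w \<noteq> None} P
    \<and> expectation P (cond_quantity c x) = x \<and> expectation P (cond_quantity d y) = y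
    \<and> expectation P (cond_quantity (conj_L c d) z) = z"
proof -
  obtain v :: "bool option \<Rightarrow> bool option \<Rightarrow> _"
    where v: "truth c (v s t) = s" "truth d (v s t) = t" for s t
    using indep unfolding jointly_unconstrained_def by metis
  let ?P = "[(z, v (Some True) (Some True)), (x - z, v (Some True) (Some False)),
    (y - z, v (Some False) (Some True)), (1 + z - x - y, v (Some False) (Some False))]"
  show ?thesis
    by (rule exI[of _ ?P])
      (use z sum in \<open>simp add: distribution_on_def expectation_def v cond_quantity_truth
        truth_conj_L del: not_None_eq\<close>)
qed

lemma fair_on_antecedent:
  assumes indep: "jointly_unconstrained c d"
    and x: "x \<le> 1" and y: "y \<le> 1" and z: "0 \<le> z" "z \<le> x" "z \<le> y"
  shows "\<exists>P. distribution_on {w. truth c w \<noteq> None} P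
    \<and> expectation P (cond_quantity c x) = x \<and> expectation P (cond_quantity d y) = y
    \<and> expectation P (cond_quantity (conj_L c d) z) = z"
proof (cases "x + y \<le> 1 + z")
  case True
  then show ?thesis
    using fair_joint_distribution[OF indep z]
    by (blast intro: distribution_on_mono[where S = "{w. truth c w \<noteq> None \<and> truth d w \<noteq> None}"])
next
  case False
  define r where "r = (1 - x) / (y - z)"
  have r: "0 \<le> r" "r \<le> 1" and eq: "r * (y - z) = 1 - x"
    using False x z unfolding r_def by (auto simp: field_simps)
  obtain v :: "bool option \<Rightarrow> bool option \<Rightarrow> _"
    where v: "truth c (v s t) = s" "truth d (v s t) = t" for s t
    using indep unfolding jointly_unconstrained_def by metis
  let ?P = "[(r * z, v (Some True) (Some True)), (r * (1 - y), v (Some True) (Some False)),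
    (1 - x, v (Some False) (Some True)), (1 - r, v (Some True) None)]"
  have dist: "distribution_on {w. truth c w \<noteq> None} ?P"
    using r y z x eq
    by (simp add: distribution_on_def expectation_def v del: not_None_eq)
      (simp add: algebra_simps)
  have "expectation ?P (cond_quantity c x) = x" "expectation ?P (cond_quantity d y) = y"
    "expectation ?P (cond_quantity (conj_L c d) z) = z"
    using eq by (simp_all add: expectation_def v cond_quantity_truth truth_conj_L)
      (simp_all add: algebra_simps)
  with dist show ?thesis by blast
qed

lemma fair_on_consequent:
  assumes indep: "jointly_unconstrained c d"
    and x: "x \<le> 1" and y: "y \<le> 1" and z: "0 \<le> z" "z \<le> x" "z \<le> y"
  shows "\<exists>P. distribution_on {w. truth d w \<noteq> None} P
    \<and> expectation P (cond_quantity c x) = x \<and> expectation P (cond_quantity d y) = y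
    \<and> expectation P (cond_quantity (conj_L c d) z) = z"
proof -
  have "jointly_unconstrained d c"
    using indep unfolding jointly_unconstrained_def by blast
  moreover have "cond_quantity (conj_L d c) z = cond_quantity (conj_L c d) z"
    by (auto simp: fun_eq_iff cond_quantity_truth truth_conj_L)
  ultimately show ?thesis
    using fair_on_antecedent[of d c y x z] assms by metis
qed

lemma fair_on_conjunction:
  assumes indep: "jointly_unconstrained c d"
    and x: "x \<le> 1" and y: "y \<le> 1" and z: "0 \<le> z" "z \<le> x" "z \<le> y"
  shows "\<exists>P. distribution_on {w. truth (conj_L c d) w \<noteq> None} P
    \<and> expectation P (cond_quantity c x) = x \<and> expectation P (cond_quantity d y) = y
    \<and> expectation P (cond_quantity (conj_L c d) z) = z"
proof (cases "x + y \<le> 1 + z")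
  case True
  then obtain P where "distribution_on {w. truth c w \<noteq> None \<and> truth d w \<noteq> None} P"
    and "expectation P (cond_quantity c x) = x" "expectation P (cond_quantity d y) = y"
      "expectation P (cond_quantity (conj_L c d) z) = z"
    using fair_joint_distribution[OF indep z] by blast
  moreover have "{w. truth c w \<noteq> None \<and> truth d w \<noteq> None} \<subseteq> {w. truth (conj_L c d) w \<noteq> None}"
    by (auto simp: truth_conj_L)
  ultimately show ?thesis
    using distribution_on_mono by blast
next
  case False
  define r where "r = z / (x + y - 1)"
  have r: "0 \<le> r" "r \<le> 1" and eq: "r * (x + y - 1) = z"
    using False z unfolding r_def by (auto simp: field_simps)
  obtain v :: "bool option \<Rightarrow> bool option \<Rightarrow> _"
    where v: "truth c (v s t) = s" "truth d (v s t) = t" for s t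
    using indep unfolding jointly_unconstrained_def by metis
  let ?P = "[(z, v (Some True) (Some True)), (r * (1 - y), v (Some True) (Some False)),
    (r * (1 - x), v (Some False) (Some True)), (1 - r, v None None)]"
  have dist: "distribution_on {w. truth (conj_L c d) w \<noteq> None} ?P"
    using r y z x eq
    by (simp add: distribution_on_def expectation_def v truth_conj_L del: not_None_eq)
      (simp add: algebra_simps)
  have "expectation ?P (cond_quantity c x) = x" "expectation ?P (cond_quantity d y) = y"
    "expectation ?P (cond_quantity (conj_L c d) z) = z"
    using eq by (simp_all add: expectation_def v cond_quantity_truth truth_conj_L)
      (simp_all add: algebra_simps)
  with dist show ?thesis by blast
qed

section \<open>Sufficiency of the bounds\<close>

text \<open>A subfamily containing \<open>c\<close>, \<open>d\<close> or their conjunction is live whenever that member is not void,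
  so the corresponding distribution applies. The iterated conditional alone is fair under the
  probability \<open>\<mu>\<close> of \<open>d\<close>, with \<open>c\<close> true and \<open>d\<close> not void.\<close>

lemma coherent_extensionI:
  assumes indep: "jointly_unconstrained c d"
    and x: "0 \<le> x" "x \<le> 1" and y: "y \<le> 1" and \<mu>: "0 \<le> \<mu>" "\<mu> \<le> 1" "x * \<mu> \<le> y"
  shows "coherent_extension c d x y \<mu>"
proof -
  define z where "z = x * \<mu>"
  have z: "0 \<le> z" "z \<le> x" "z \<le> y"
    using x \<mu> mult_left_mono[of \<mu> 1 x] unfolding z_def by auto
  let ?bs = "iter_L_family c d x y z \<mu>"
  have "\<exists>P. distribution_on (live_cases ?bs J) P \<and>
      (\<forall>j\<in>J. expectation P (quantity (?bs ! j)) = price (?bs ! j))"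
    if J: "J \<subseteq> {..<length ?bs}" "J \<noteq> {}" for J
  proof -
    have members: "j = 0 \<or> j = 1 \<or> j = 2 \<or> j = 3" if "j \<in> J" for j
      using J(1) that by auto
    have fair: ?thesis
      if P: "distribution_on S P" and S: "S \<subseteq> live_cases ?bs J"
        and E: "expectation P (cond_quantity c x) = x" "expectation P (cond_quantity d y) = y"
          "expectation P (cond_quantity (conj_L c d) z) = z"
      for P S
    proof -
      have "expectation P (iter_L_quantity d c x z \<mu>) = z + (- \<mu> * x + \<mu>)"
        unfolding iter_L_quantity_eq expectation_add expectation_cmult expectation_const[OF P] E ..
      then have "expectation P (iter_L_quantity d c x z \<mu>) = \<mu>"
        by (simp add: z_def)
      then have "\<forall>j\<in>J. expectation P (quantity (?bs ! j)) = price (?bs ! j)"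
        using members E by (fastforce simp: cond_bet_def iter_L_bet_def)
      then show ?thesis
        using distribution_on_mono[OF P S] by blast
    qed
    consider "0 \<in> J" | "1 \<in> J" | "2 \<in> J" | "J = {3}"
      using members J(2) by blast
    then show ?thesis
    proof cases
      case 1
      have "{w. truth c w \<noteq> None} \<subseteq> live_cases ?bs J"
        using 1 by (force simp: live_cases_def cond_bet_def void_iff_truth)
      then show ?thesis
        using fair_on_antecedent[OF indep x(2) y z] fair by blast
    next
      case 2
      have "{w. truth d w \<noteq> None} \<subseteq> live_cases ?bs J"
        using 2 by (force simp: live_cases_def cond_bet_def void_iff_truth)
      then show ?thesis
        using fair_on_consequent[OF indep x(2) y z] fair by blast
    next
      case 3
      have "{w. truth (conj_L c d) w \<noteq> None} \<subseteq> live_cases ?bs J"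
        using 3 by (force simp: live_cases_def cond_bet_def void_iff_truth)
      then show ?thesis
        using fair_on_conjunction[OF indep x(2) y z] fair by blast
    next
      case 4
      obtain u w where u: "truth c u = Some True" "truth d u = Some True"
        and w: "truth c w = Some True" "truth d w = Some False"
        using indep unfolding jointly_unconstrained_def by metis
      have "iter_L_quantity d c x (x * 0) 0 u \<noteq> 0"
        unfolding iter_L_quantity_truth by (simp add: u)
      then have u_live: "\<exists>m. iter_L_quantity d c x (x * m) m u \<noteq> m" ..
      have "iter_L_quantity d c x (x * 1) 1 w \<noteq> 1"
        unfolding iter_L_quantity_truth by (simp add: w)
      then have w_live: "\<exists>m. iter_L_quantity d c x (x * m) m w \<noteq> m" ..
      have "u \<in> live_cases ?bs J" "w \<in> live_cases ?bs J"
        unfolding 4 using u_live w_live by (simp_all add: live_cases_def iter_L_bet_def)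
      then have "distribution_on (live_cases ?bs J) [(\<mu>, u), (1 - \<mu>, w)]"
        using \<mu> by (simp add: distribution_on_def expectation_def)
      moreover have "expectation [(\<mu>, u), (1 - \<mu>, w)] (iter_L_quantity d c x z \<mu>) = \<mu>"
        by (simp add: expectation_def z_def iter_L_quantity_truth u w)
      ultimately show ?thesis
        unfolding 4 by (intro exI[of _ "[(\<mu>, u), (1 - \<mu>, w)]"]) (simp add: iter_L_bet_def)
    qed
  qed
  then have "coherent ?bs"
    by (rule coherentI[OF finite_range_iter_L_family])
  then show ?thesis
    unfolding coherent_extension_def by blast
qed

theorem theorem14:
  fixes A B H K :: "'w set" and x y \<mu> :: real
  assumes "logically_independent A B H K"
    and "coherent [cond_bet (A \<parallel> H) x, cond_bet (B \<parallel> K) y]"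
  shows "coherent_extension (A \<parallel> H) (B \<parallel> K) x y \<mu> \<longleftrightarrow>
    \<mu> \<in> {0 .. (if x > 0 then min 1 (y / x) else 1)}"
proof -
  let ?c = "A \<parallel> H" and ?d = "B \<parallel> K"
  have indep: "jointly_unconstrained ?c ?d"
    using assms(1) by (rule logically_independent_imp_jointly_unconstrained)
  then obtain w where w: "truth ?c w = Some True" "truth ?d w = Some True"
    unfolding jointly_unconstrained_def by blast
  have fin: "\<forall>b\<in>set [cond_bet ?c x, cond_bet ?d y]. finite (range (quantity b))"
    by (simp add: finite_range_cond_bet)
  have x: "0 \<le> x" "x \<le> 1"
    using coherent_cond_bet_unit_interval[OF assms(2) fin, of 0 ?c x w] w by (simp_all del: truth.simps)
  have y: "0 \<le> y" "y \<le> 1"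
    using coherent_cond_bet_unit_interval[OF assms(2) fin, of 1 ?d y w] w by (simp_all del: truth.simps)
  have "coherent_extension ?c ?d x y \<mu> \<longleftrightarrow> 0 \<le> \<mu> \<and> \<mu> \<le> 1 \<and> x * \<mu> \<le> y"
    using coherent_extension_bounds[OF indep _ x y(1)] coherent_extensionI[OF indep x y(2)]
    by blast
  also have "\<dots> \<longleftrightarrow> \<mu> \<in> {0 .. (if x > 0 then min 1 (y / x) else 1)}"
    using x y by (auto simp: field_simps)
  finally show ?thesis .
qed

end
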